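(* As $n \to \infty$, $$V(n) \geq \frac{1675}{32768}\, n^2 (1+o(1)).$$ That is, there is a sequence of real numbers $\varepsilon_n \to 0$ such that $V(n) \ge \frac{1675}{32768} n^2(1+\varepsilon_n)$ for all positive integers $n$.
   Context: For a positive integer $n$, write $[1,n]=\{1,2,\dots,n\}$. A $2$-coloring of $[1,n]$ is a function $\chi:[1,n]\to\{0,1\}$. A $3$-term arithmetic progression in $[1,n]$ is a triple $a, a+d, a+2d$ of elements of $[1,n]$ with $d\ge 1$ (so progressions are unordered, and there are $\frac{n^2}{4}(1+o(1))$ of them); it is monochromatic under $\chi$ if $\chi(a)=\chi(a+d)=\chi(a+2d)$. $V(n)$ denotes the minimum, over all $2$-colorings $\chi$ of $[1,n]$, of the number of $3$-term arithmetic progressions in $[1,n]$ that are monochromatic under $\chi$. *)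

theory Defs
  imports Complex_Main "HOL-Library.FuncSet"
begin

(* Extensional functions, so that each 2-coloring of [1,n] is represented exactly once. *)
definition two_colorings :: "nat \<Rightarrow> (nat \<Rightarrow> nat) set" where
  "two_colorings n = {1..n} \<rightarrow>\<^sub>E {0, 1}"

definition ap3 :: "nat \<Rightarrow> (nat \<times> nat \<times> nat) set" where
  "ap3 n = {(a, a + d, a + 2 * d) | a d.
     d \<ge> 1 \<and> a \<in> {1..n} \<and> a + d \<in> {1..n} \<and> a + 2 * d \<in> {1..n}}"

definition mono_ap3 :: "nat \<Rightarrow> (nat \<Rightarrow> nat) \<Rightarrow> (nat \<times> nat \<times> nat) set" where
  "mono_ap3 n \<chi> = {(x, y, z) \<in> ap3 n. \<chi> x = \<chi> y \<and> \<chi> y = \<chi> z}"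

definition V :: "nat \<Rightarrow> nat" where
  "V n = Min ((\<lambda>\<chi>. card (mono_ap3 n \<chi>)) ` two_colorings n)"

(* The sets underlying Min and card are well behaved, so neither takes a default value. *)

lemma finite_two_colorings: "finite (two_colorings n)"
  unfolding two_colorings_def by (intro finite_PiE) auto

lemma two_colorings_nonempty: "two_colorings n \<noteq> {}"
  unfolding two_colorings_def by (simp add: PiE_eq_empty_iff)

lemma finite_ap3: "finite (ap3 n)"
  by (rule finite_subset[of _ "{1..n} \<times> {1..n} \<times> {1..n}"]) (auto simp: ap3_def)

lemma finite_mono_ap3: "finite (mono_ap3 n \<chi>)"
  by (rule finite_subset[OF _ finite_ap3[of n]]) (auto simp: mono_ap3_def)

end

theory Submission
  imports Defs
begin

text \<open>Encode the two colors as signs \<open>x i = 1\<close> and \<open>x i = -1\<close>. For three signs,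
\<open>1 + ab + bc + ac\<close> is \<open>4\<close> if they agree and \<open>0\<close> otherwise, so four times the number of
monochromatic progressions is the number of all progressions plus the sum of \<open>x i * x j\<close> over the
three kinds of pairs (first and middle, middle and last, first and last) in a progression. Let
\<open>S\<close> be the sum of all signs, \<open>T x\<close> the sum of \<open>x i * x j\<close> over all index pairs with
\<open>j \<le> 2 * i\<close>, and \<open>x'\<close> the coloring reflected in the middle of the interval. Up to an error linear
in \<open>N\<close>, four times the number of monochromatic progressions in an interval of length \<open>N\<close> is at
least \<open>N^2 / 4 + T x + T x' - 3/4 S^2\<close> (lemma \<open>card_mono_ap3_ge\<close>).

It remains to bound a quadratic form from below on sign vectors. Cut the interval into 72 blocks of
length \<open>k\<close>. The condition \<open>j \<le> 2 * i\<close> is constantly true or constantly false when \<open>i\<close> and \<open>j\<close> run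
through blocks \<open>u\<close> and \<open>v\<close>, unless \<open>v\<close> is \<open>2 * u\<close> or \<open>2 * u + 1\<close>. On such a cell, formed by one
block and a pair of adjacent blocks, its indicator is \<open>1/2\<close> plus half a sign kernel. The kernel has
total sum \<open>0\<close>, so it only measures how far \<open>x\<close> deviates from its block means, and because \<open>x\<close> takes the
values \<open>1\<close> and \<open>-1\<close>, the squared deviations in a block with sum \<open>s\<close> add up to exactly
\<open>k - s^2 / k\<close>. Weighted AM-GM thus bounds the kernel contribution by a multiple of \<open>k^2\<close> and
squares of block sums (lemma \<open>cell_sum_ge\<close>). Blocks on which \<open>x\<close> is
nearly constant have small deviations, and the other blocks have small means.

After this step there remains a constant multiple of \<open>k^2\<close> and a quadratic form in the 72 block sums.
The AM-GM weights are free. They are chosen such that this form, together with its reflection, is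
positive semidefinite, and such that the constant is \<open>- 707/3 k^2\<close>. Splitting a vector of block sums
into its parts that are even and odd under reflection turns semidefiniteness into the same question
for two integer matrices of size 36, and Gaussian elimination with rounding decides that. Finally,
\<open>N = 72 * k\<close> gives \<open>707/3 k^2 = 707/15552 N^2\<close>, and \<open>1/4 - 707/15552\<close> exceeds
\<open>1675/8192 = 4 * 1675/32768\<close>.\<close>

section \<open>Counting monochromatic progressions with signs\<close>

lemma sum_symmetric_square:
  fixes h :: "nat \<Rightarrow> nat \<Rightarrow> real"
  assumes "\<And>i j. h i j = h j i"
  shows "(\<Sum>i<N. \<Sum>j<N. h i j) = (\<Sum>i<N. h i i) + 2 * (\<Sum>j<N. \<Sum>i<j. h i j)"
proof (induction N)
  case (Suc N)
  have "(\<Sum>i<N. h i N) = (\<Sum>i<N. h N i)" by (intro sum.cong refl assms)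
  then show ?case using Suc by (simp add: sum.distrib)
qed simp

definition pairs :: "nat \<Rightarrow> (nat \<Rightarrow> nat \<Rightarrow> bool) \<Rightarrow> (nat \<times> nat) set" where
  "pairs N R = {(i, j). i < j \<and> j < N \<and> R i j}"

lemma sum_pairs:
  fixes f :: "nat \<Rightarrow> nat \<Rightarrow> real"
  shows "(\<Sum>(i, j)\<in>pairs N R. f i j) = (\<Sum>j<N. \<Sum>i<j. if R i j then f i j else 0)"
proof -
  have eq: "pairs N R = (\<lambda>(j, i). (i, j)) ` (SIGMA j:{..<N}. {i \<in> {..<j}. R i j})"
    by (auto simp: pairs_def image_iff)
  have "(\<Sum>(i, j)\<in>pairs N R. f i j) = (\<Sum>(j, i)\<in>(SIGMA j:{..<N}. {i \<in> {..<j}. R i j}). f i j)"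
    unfolding eq by (subst sum.reindex) (auto simp: inj_on_def split_def)
  also have "\<dots> = (\<Sum>j<N. \<Sum>i\<in>{i \<in> {..<j}. R i j}. f i j)"
    by (rule sum.Sigma[symmetric]) auto
  finally show ?thesis by (simp only: sum.inter_filter finite_lessThan)
qed

text \<open>The factor 2 comes from the progressions themselves: in zero-based positions, \<open>i < j\<close> are the middle
and last term of a progression in the interval exactly if the first term \<open>2 * i - j\<close> is not negative.
Summing over all ordered pairs, not only over \<open>i < j\<close>, makes the later cutting into blocks uniform.\<close>

definition below_double :: "nat \<Rightarrow> (nat \<Rightarrow> real) \<Rightarrow> real" where
  "below_double N x = (\<Sum>i<N. \<Sum>j<N. if j \<le> 2 * i then x i * x j else 0)"

text \<open>For natural numbers at least one of \<open>j \<le> 2 * i\<close> and \<open>i \<le> 2 * j\<close> holds. So their indicators add up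
to \<open>1\<close> plus the indicator of both, and for \<open>i < j\<close> the second condition is automatic.\<close>

lemma sum_last_pair:
  assumes x: "\<And>i. (x i)\<^sup>2 = (1::real)"
  shows "(\<Sum>(i, j)\<in>pairs N (\<lambda>i j. j \<le> 2 * i). x i * x j)
           = below_double N x - (\<Sum>i<N. x i)\<^sup>2 / 2 - N / 2"
proof -
  define h where "h i j = ((if j \<le> 2 * i then 1 else 0) + (if i \<le> 2 * j then 1 else 0) - 1) * (x i * x j)" for i j :: nat
  have xx: "x i * x i = 1" for i using x[of i] by (simp add: power2_eq_square)
  have "(\<Sum>i<N. \<Sum>j<N. h i j) = (\<Sum>i<N. h i i) + 2 * (\<Sum>j<N. \<Sum>i<j. h i j)"
    by (rule sum_symmetric_square) (auto simp: h_def)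
  moreover have "(\<Sum>i<N. h i i) = N" by (simp add: h_def xx)
  moreover have "(\<Sum>j<N. \<Sum>i<j. h i j) = (\<Sum>(i, j)\<in>pairs N (\<lambda>i j. j \<le> 2 * i). x i * x j)"
    unfolding sum_pairs by (intro sum.cong refl) (auto simp: h_def)
  moreover have "(\<Sum>i<N. \<Sum>j<N. h i j) = 2 * below_double N x - (\<Sum>i<N. x i)\<^sup>2"
  proof -
    have "(\<Sum>i<N. \<Sum>j<N. if i \<le> 2 * j then x i * x j else 0) = below_double N x"
      unfolding below_double_def by (subst sum.swap) (intro sum.cong refl, auto)
    moreover have "(\<Sum>i<N. \<Sum>j<N. h i j) = below_double N x
        + (\<Sum>i<N. \<Sum>j<N. if i \<le> 2 * j then x i * x j else 0) - (\<Sum>i<N. \<Sum>j<N. x i * x j)"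
      unfolding below_double_def sum.distrib[symmetric] sum_subtractf[symmetric]
      by (intro sum.cong refl) (auto simp: h_def)
    ultimately show ?thesis by (simp add: power2_eq_square sum_product)
  qed
  ultimately show ?thesis by simp
qed

text \<open>Reflecting the interval exchanges the first and the last term of a progression.\<close>

lemma sum_first_pair:
  assumes x: "\<And>i. (x i)\<^sup>2 = (1::real)"
  shows "(\<Sum>(i, j)\<in>pairs N (\<lambda>i j. 2 * j < N + i). x i * x j)
           = below_double N (\<lambda>i. x (N - Suc i)) - (\<Sum>i<N. x i)\<^sup>2 / 2 - N / 2"
proof -
  have "(\<Sum>(i, j)\<in>pairs N (\<lambda>i j. 2 * j < N + i). x i * x j)
      = (\<Sum>(i, j)\<in>pairs N (\<lambda>i j. j \<le> 2 * i). x (N - Suc i) * x (N - Suc j))"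
    by (rule sum.reindex_bij_witness[of _ "\<lambda>(i, j). (N - Suc j, N - Suc i)" "\<lambda>(i, j). (N - Suc j, N - Suc i)"])
      (auto simp: pairs_def)
  moreover have "(\<Sum>i<N. x (N - Suc i)) = (\<Sum>i<N. x i)"
    by (rule sum.nat_diff_reindex)
  ultimately show ?thesis
    using sum_last_pair[of "\<lambda>i. x (N - Suc i)" N] x by simp
qed

text \<open>The end points of a progression have equal parity, and any two distinct positions of equal parity are end points.
The indicator of equal parity is \<open>(1 + (-1)^i * (-1)^j) / 2\<close>, so the sum over all ordered pairs is half
the sum of two squares. With \<open>x = 1\<close> this bound also counts all progressions.\<close>

lemma sum_end_pair_ge:
  assumes x: "\<And>i. (x i)\<^sup>2 = (1::real)"
  shows "(\<Sum>(i, j)\<in>pairs N (\<lambda>i j. even (i + j)). x i * x j) \<ge> (\<Sum>i<N. x i)\<^sup>2 / 4 - N / 2"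
proof -
  define h where "h i j = (x i * x j + ((-1) ^ i * x i) * ((-1) ^ j * x j)) / 2" for i j :: nat
  have h: "h i j = (if even (i + j) then x i * x j else 0)" for i j
    by (cases "even i"; cases "even j") (auto simp: h_def)
  have xx: "x i * x i = 1" for i using x[of i] by (simp add: power2_eq_square)
  have "(\<Sum>i<N. \<Sum>j<N. h i j) = (\<Sum>i<N. h i i) + 2 * (\<Sum>j<N. \<Sum>i<j. h i j)"
    by (rule sum_symmetric_square) (auto simp: h_def)
  moreover have "(\<Sum>i<N. h i i) = N" by (simp add: h xx)
  moreover have "(\<Sum>j<N. \<Sum>i<j. h i j) = (\<Sum>(i, j)\<in>pairs N (\<lambda>i j. even (i + j)). x i * x j)"
    unfolding sum_pairs by (intro sum.cong refl) (auto simp: h)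
  moreover have "(\<Sum>i<N. \<Sum>j<N. h i j) = ((\<Sum>i<N. x i)\<^sup>2 + (\<Sum>i<N. (-1) ^ i * x i)\<^sup>2) / 2"
    unfolding h_def sum_divide_distrib[symmetric] sum.distrib
    by (simp add: power2_eq_square sum_product)
  moreover have "0 \<le> (\<Sum>i<N. (-1) ^ i * x i)\<^sup>2" by simp
  ultimately show ?thesis by argo
qed

lemma sum_ap3_last:
  fixes f :: "nat \<Rightarrow> nat \<Rightarrow> real"
  shows "(\<Sum>(a, b, c)\<in>ap3 N. f (b - 1) (c - 1)) = (\<Sum>(i, j)\<in>pairs N (\<lambda>i j. j \<le> 2 * i). f i j)"
proof (rule sum.reindex_bij_witness[of _ "\<lambda>(i, j). (2 * i - j + 1, i + 1, j + 1)" "\<lambda>(a, b, c). (b - 1, c - 1)"])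
  fix ij assume "ij \<in> pairs N (\<lambda>i j. j \<le> 2 * i)"
  then obtain i j where ij: "ij = (i, j)" "i < j" "j < N" "j \<le> 2 * i" by (auto simp: pairs_def)
  then have "\<exists>d. j = i + d" by presburger
  then obtain d where "j = i + d" ..
  then show "(case ij of (i, j) \<Rightarrow> (2 * i - j + 1, i + 1, j + 1)) \<in> ap3 N"
    using ij by (auto simp: ap3_def intro!: exI[of _ d])
qed (auto simp: pairs_def ap3_def)

lemma sum_ap3_first:
  fixes f :: "nat \<Rightarrow> nat \<Rightarrow> real"
  shows "(\<Sum>(a, b, c)\<in>ap3 N. f (a - 1) (b - 1)) = (\<Sum>(i, j)\<in>pairs N (\<lambda>i j. 2 * j < N + i). f i j)"
proof (rule sum.reindex_bij_witness[of _ "\<lambda>(i, j). (i + 1, j + 1, 2 * j - i + 1)" "\<lambda>(a, b, c). (a - 1, b - 1)"])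
  fix ij assume "ij \<in> pairs N (\<lambda>i j. 2 * j < N + i)"
  then obtain i j where ij: "ij = (i, j)" "i < j" "j < N" "2 * j < N + i" by (auto simp: pairs_def)
  then have "\<exists>d. j = i + d" by presburger
  then obtain d where "j = i + d" ..
  then show "(case ij of (i, j) \<Rightarrow> (i + 1, j + 1, 2 * j - i + 1)) \<in> ap3 N"
    using ij by (auto simp: ap3_def intro!: exI[of _ d])
qed (auto simp: pairs_def ap3_def)

lemma sum_ap3_ends:
  fixes f :: "nat \<Rightarrow> nat \<Rightarrow> real"
  shows "(\<Sum>(a, b, c)\<in>ap3 N. f (a - 1) (c - 1)) = (\<Sum>(i, j)\<in>pairs N (\<lambda>i j. even (i + j)). f i j)"
proof (rule sum.reindex_bij_witness[of _ "\<lambda>(i, j). (i + 1, (i + j) div 2 + 1, j + 1)" "\<lambda>(a, b, c). (a - 1, c - 1)"])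
  fix ij assume "ij \<in> pairs N (\<lambda>i j. even (i + j))"
  then obtain i j where ij: "ij = (i, j)" "i < j" "j < N" "even (i + j)" by (auto simp: pairs_def)
  define d where "d = (j - i) div 2"
  have "j = i + 2 * d" using ij by (auto simp: d_def)
  then show "(case ij of (i, j) \<Rightarrow> (i + 1, (i + j) div 2 + 1, j + 1)) \<in> ap3 N"
    using ij by (auto simp: ap3_def)
qed (auto simp: pairs_def ap3_def)

lemma card_mono_ap3_ge:
  assumes "\<chi> \<in> two_colorings n" "N \<le> n"
  obtains x :: "nat \<Rightarrow> real" where "\<And>i. (x i)\<^sup>2 = 1"
    "4 * real (card (mono_ap3 n \<chi>)) \<ge> real N ^ 2 / 4 - 2 * real N
       + below_double N x + below_double N (\<lambda>i. x (N - Suc i)) - 3 / 4 * (\<Sum>i<N. x i)\<^sup>2"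
proof -
  define x :: "nat \<Rightarrow> real" where "x i = (if \<chi> (i + 1) = 0 then 1 else - 1)" for i
  have x: "(x i)\<^sup>2 = 1" for i by (simp add: x_def)
  have "card (mono_ap3 N \<chi>) \<le> card (mono_ap3 n \<chi>)"
    using assms(2) by (intro card_mono finite_mono_ap3) (auto simp: mono_ap3_def ap3_def)
  then have "4 * real (card (mono_ap3 n \<chi>)) \<ge> 4 * real (card (mono_ap3 N \<chi>))" by simp
  also have "4 * real (card (mono_ap3 N \<chi>)) = (\<Sum>t\<in>mono_ap3 N \<chi>. 4)" by simp
  also have "\<dots> = (\<Sum>t\<in>ap3 N. if t \<in> mono_ap3 N \<chi> then 4 else 0)"
    unfolding sum.inter_filter[OF finite_ap3, symmetric]
    by (intro sum.cong) (auto simp: mono_ap3_def)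
  also have "\<dots> = (\<Sum>(a, b, c)\<in>ap3 N. 1 + x (a - 1) * x (b - 1) + x (b - 1) * x (c - 1) + x (a - 1) * x (c - 1))"
  proof (rule sum.cong[OF refl], clarify)
    fix a b c assume abc: "(a, b, c) \<in> ap3 N"
    have "\<chi> a \<in> {0, 1} \<and> \<chi> b \<in> {0, 1} \<and> \<chi> c \<in> {0, 1}"
      using assms abc by (auto simp: two_colorings_def ap3_def PiE_iff)
    moreover have "x (a - 1) = (if \<chi> a = 0 then 1 else -1)" "x (b - 1) = (if \<chi> b = 0 then 1 else -1)"
      "x (c - 1) = (if \<chi> c = 0 then 1 else -1)" using abc by (auto simp: x_def ap3_def)
    ultimately show "(if (a, b, c) \<in> mono_ap3 N \<chi> then 4 else 0)
       = 1 + x (a - 1) * x (b - 1) + x (b - 1) * x (c - 1) + x (a - 1) * x (c - 1)"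
      using abc by (auto simp: mono_ap3_def)
  qed
  also have "\<dots> = (\<Sum>(i, j)\<in>pairs N (\<lambda>i j. even (i + j)). 1 * 1)
     + (\<Sum>(i, j)\<in>pairs N (\<lambda>i j. 2 * j < N + i). x i * x j)
     + (\<Sum>(i, j)\<in>pairs N (\<lambda>i j. j \<le> 2 * i). x i * x j)
     + (\<Sum>(i, j)\<in>pairs N (\<lambda>i j. even (i + j)). x i * x j)"
    unfolding sum_ap3_ends[symmetric] sum_ap3_first[symmetric] sum_ap3_last[symmetric]
    by (simp add: sum.distrib split_def)
  finally have main: "(\<Sum>(i, j)\<in>pairs N (\<lambda>i j. even (i + j)). 1 * 1)
     + (\<Sum>(i, j)\<in>pairs N (\<lambda>i j. 2 * j < N + i). x i * x j)
     + (\<Sum>(i, j)\<in>pairs N (\<lambda>i j. j \<le> 2 * i). x i * x j)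
     + (\<Sum>(i, j)\<in>pairs N (\<lambda>i j. even (i + j)). x i * x j) \<le> 4 * real (card (mono_ap3 n \<chi>))" .
  have "(\<Sum>(i, j)\<in>pairs N (\<lambda>i j. even (i + j)). 1 * 1) \<ge> real N ^ 2 / 4 - N / 2"
    using sum_end_pair_ge[of "\<lambda>_. 1" N] by simp
  with main sum_end_pair_ge[of x N, OF x] show thesis
    unfolding sum_first_pair[OF x] sum_last_pair[OF x]
    by (intro that[of x] x) argo
qed

section \<open>The sign kernel of a single cell\<close>

text \<open>The position \<open>2 * u * k + t\<close> in the pair of blocks \<open>2 * u\<close> and \<open>2 * u + 1\<close> is at most twice the position
\<open>u * k + r\<close> in block \<open>u\<close> exactly if \<open>t \<le> 2 * r\<close>. The kernel below is twice the indicator of this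
condition minus \<open>1\<close>; it does not depend on \<open>u\<close>.\<close>

definition cell_sign :: "nat \<Rightarrow> nat \<Rightarrow> real" where
  "cell_sign r t = (if t \<le> 2 * r then 1 else - 1)"

lemma sum_cell_sign_row: "r < k \<Longrightarrow> (\<Sum>t<2 * k. cell_sign r t) = 4 * real r + 2 - 2 * real k"
proof -
  have "(\<Sum>t<n. cell_sign r t) = 2 * real (min n (2 * r + 1)) - real n" for n
    by (induction n) (auto simp: cell_sign_def min_def)
  then show "r < k \<Longrightarrow> ?thesis" by simp
qed

lemma sum_cell_sign_col: "t < 2 * k \<Longrightarrow> (\<Sum>r<k. cell_sign r t) = real k - 2 * real ((t + 1) div 2)"
proof -
  have "(\<Sum>r<n. cell_sign r t) = real n - 2 * real (min n ((t + 1) div 2))" for n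
    by (induction n) (auto simp: cell_sign_def min_def)
  then show "t < 2 * k \<Longrightarrow> ?thesis" by simp
qed

lemma sum_squares_progression:
  fixes c :: real
  shows "(\<Sum>u<m. (c - 2 * real u)\<^sup>2)
    = m * c\<^sup>2 - 2 * c * m * (real m - 1) + 2 / 3 * m * (real m - 1) * (2 * real m - 1)"
  by (induction m) (simp_all add: power2_eq_square field_simps)

lemma sum_cell_sign_row_squares: "(\<Sum>r<k. (\<Sum>t<2 * k. cell_sign r t)\<^sup>2) \<le> 4 / 3 * real k ^ 3"
proof -
  have "(\<Sum>r<k. (\<Sum>t<2 * k. cell_sign r t)\<^sup>2) = (\<Sum>r<k. 4 * ((real k - 1) - 2 * real r)\<^sup>2)"
    by (intro sum.cong refl, subst sum_cell_sign_row) (auto simp: power2_eq_square algebra_simps)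
  also have "\<dots> = 4 / 3 * real k ^ 3 - 4 / 3 * real k"
    unfolding sum_distrib_left[symmetric] sum_squares_progression
    by (simp add: power2_eq_square power3_eq_cube field_simps)
  finally show ?thesis by simp
qed

lemma sum_cell_sign_col_squares:
  "(\<Sum>t<2 * k. (\<Sum>r<k. cell_sign r t)\<^sup>2) = 2 / 3 * real k ^ 3 + 4 / 3 * real k"
proof -
  have pair: "(\<Sum>t<2 * m. g t) = (\<Sum>u<m. g (2 * u) + g (2 * u + 1))" for m and g :: "nat \<Rightarrow> real"
    by (induction m) auto
  have "(\<Sum>t<2 * k. (\<Sum>r<k. cell_sign r t)\<^sup>2) = (\<Sum>t<2 * k. (real k - 2 * real ((t + 1) div 2))\<^sup>2)"
    by (intro sum.cong refl) (simp add: sum_cell_sign_col)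
  also have "\<dots> = (\<Sum>u<k. (real k - 2 * real u)\<^sup>2 + ((real k - 2) - 2 * real u)\<^sup>2)"
    unfolding pair by (intro sum.cong refl) (simp add: algebra_simps)
  also have "\<dots> = 2 / 3 * real k ^ 3 + 4 / 3 * real k"
    unfolding sum.distrib sum_squares_progression
    by (simp add: power2_eq_square power3_eq_cube field_simps)
  finally show ?thesis .
qed

lemma sum_square_deviation:
  fixes y :: "nat \<Rightarrow> real"
  assumes "\<And>i. (y i)\<^sup>2 = 1" "0 < n"
  shows "(\<Sum>i<n. (y i - (\<Sum>i<n. y i) / n)\<^sup>2) = n - (\<Sum>i<n. y i)\<^sup>2 / n"
proof -
  define a where "a = (\<Sum>i<n. y i) / n"
  have s: "(\<Sum>i<n. y i) = n * a" using assms(2) by (simp add: a_def)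
  have "(\<Sum>i<n. (y i - a)\<^sup>2) = (\<Sum>i<n. 1 - 2 * a * y i + a\<^sup>2)"
    by (intro sum.cong refl) (simp add: power2_diff assms(1))
  also have "\<dots> = n - 2 * a * (n * a) + n * a\<^sup>2"
    unfolding s[symmetric] by (simp add: sum.distrib sum_subtractf sum_distrib_left)
  also have "\<dots> = n - (\<Sum>i<n. y i)\<^sup>2 / n"
    unfolding s using assms(2) by (simp add: power2_eq_square field_simps)
  finally show ?thesis by (simp only: a_def)
qed

lemma weighted_am_gm:
  fixes w x y :: real
  assumes "0 < w"
  shows "- (w * x\<^sup>2 + y\<^sup>2 / (4 * w)) \<le> x * y"
proof -
  have "0 \<le> (2 * w * x + y)\<^sup>2 / (4 * w)" using assms by simp
  also have "\<dots> = w * x\<^sup>2 + x * y + y\<^sup>2 / (4 * w)"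
    using assms by (simp add: power2_eq_square field_simps)
  finally show ?thesis by linarith
qed

text \<open>This bounds the pairing of a deviation \<open>f\<close> with a multiple \<open>c\<close> of a known function \<open>h\<close>; \<open>c\<close> will be a
block mean and \<open>h\<close> a row or column sum of the kernel.\<close>

lemma sum_weighted_am_gm:
  fixes f h :: "'a \<Rightarrow> real"
  assumes "0 < w"
  shows "- (w * (\<Sum>i\<in>A. (f i)\<^sup>2)) - c\<^sup>2 / (4 * w) * (\<Sum>i\<in>A. (h i)\<^sup>2) \<le> (\<Sum>i\<in>A. f i * (c * h i))"
proof -
  have "- (w * (\<Sum>i\<in>A. (f i)\<^sup>2)) - c\<^sup>2 / (4 * w) * (\<Sum>i\<in>A. (h i)\<^sup>2)
      = (\<Sum>i\<in>A. - (w * (f i)\<^sup>2 + (c * h i)\<^sup>2 / (4 * w)))"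
    by (simp add: sum_distrib_left sum_subtractf sum_negf power_mult_distrib)
  also have "\<dots> \<le> (\<Sum>i\<in>A. f i * (c * h i))"
    by (intro sum_mono weighted_am_gm assms)
  finally show ?thesis .
qed

text \<open>Write \<open>y = a + g\<close> and \<open>z = b + e\<close> with the means \<open>a\<close> and \<open>b\<close>. The kernel has total sum \<open>0\<close>, so the
term with \<open>a * b\<close> vanishes. The term with \<open>g\<close> and \<open>e\<close> is bounded pointwise, as the kernel is a sign.
The two mixed terms only involve row or column sums, which grow linearly and have small square sums.
The weights \<open>P\<close> and \<open>Q\<close> set how much deviation of \<open>y\<close> and \<open>z\<close> is paid for absorbing these terms. A
larger \<open>P\<close> costs more in the constant term and improves the coefficients of both \<open>s^2\<close> and \<open>S^2\<close>,
and so does a larger \<open>Q\<close>. The factor \<open>24\<close> only serves to make good weights small integers.\<close>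

lemma cell_sum_ge:
  fixes y z :: "nat \<Rightarrow> real" and P Q :: real
  assumes k: "0 < k" and y: "\<And>i. (y i)\<^sup>2 = 1" and z: "\<And>i. (z i)\<^sup>2 = 1" and P: "0 < P" and Q: "0 < Q"
  defines "s \<equiv> \<Sum>r<k. y r" and "S \<equiv> \<Sum>t<2 * k. z t"
  shows "(\<Sum>r<k. \<Sum>t<2 * k. cell_sign r t * (y r * z t))
    \<ge> - 2 * (real k)\<^sup>2 * (1 + (P + Q) / 24) + (1 + P / 12 - 4 / Q) * s\<^sup>2
        + (1 / 4 + Q / 48 - 1 / P) * S\<^sup>2 - 8 / Q"
proof -
  define a where "a = s / k"
  define b where "b = S / (2 * k)"
  define g where "g r = y r - a" for r
  define e where "e t = z t - b" for t
  let ?row = "\<lambda>r. \<Sum>t<2 * k. cell_sign r t" and ?col = "\<lambda>t. \<Sum>r<k. cell_sign r t"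
  have a: "k * a = s" and b: "2 * k * b = S" using k by (auto simp: a_def b_def)
  have g2: "(\<Sum>r<k. (g r)\<^sup>2) = k - s\<^sup>2 / k"
    using sum_square_deviation[OF y k] by (simp add: g_def a_def s_def)
  have e2: "(\<Sum>t<2 * k. (e t)\<^sup>2) = 2 * k - S\<^sup>2 / (2 * k)"
    using sum_square_deviation[OF z, of "2 * k"] k by (simp add: e_def b_def S_def)
  have "(\<Sum>r<k. ?row r) = (\<Sum>r<k. 4 * real r + 2 - 2 * real k)"
    by (intro sum.cong refl) (simp add: sum_cell_sign_row)
  also have "\<dots> = 0"
  proof -
    have "(\<Sum>r<n. 4 * real r + 2 - 2 * real k) = 2 * real n * (real n - real k)" for n
      by (induction n) (simp_all add: algebra_simps)
    then show ?thesis by simp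
  qed
  finally have total: "(\<Sum>r<k. ?row r) = 0" .
  have "(\<Sum>r<k. \<Sum>t<2 * k. cell_sign r t * (y r * z t))
      = (\<Sum>r<k. \<Sum>t<2 * k. cell_sign r t * (g r * e t) + b * (g r * cell_sign r t)
           + a * (e t * cell_sign r t) + a * b * cell_sign r t)"
    by (intro sum.cong refl) (simp add: g_def e_def algebra_simps)
  also have "\<dots> = (\<Sum>r<k. \<Sum>t<2 * k. cell_sign r t * (g r * e t))
       + (\<Sum>r<k. g r * (b * ?row r)) + (\<Sum>t<2 * k. e t * (a * ?col t)) + a * b * (\<Sum>r<k. ?row r)"
    unfolding sum.distrib sum_distrib_left
    by (subst (5) sum.swap) (simp add: algebra_simps)
  finally have expand: "(\<Sum>r<k. \<Sum>t<2 * k. cell_sign r t * (y r * z t)) = 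
     (\<Sum>r<k. \<Sum>t<2 * k. cell_sign r t * (g r * e t))
       + (\<Sum>r<k. g r * (b * ?row r)) + (\<Sum>t<2 * k. e t * (a * ?col t))"
    by (simp add: total)
  have "(\<Sum>r<k. \<Sum>t<2 * k. cell_sign r t * (g r * e t)) \<ge> (\<Sum>r<k. \<Sum>t<2 * k. - ((g r)\<^sup>2 / 2 + (e t)\<^sup>2 / 2))"
  proof (intro sum_mono)
    fix r t
    show "- ((g r)\<^sup>2 / 2 + (e t)\<^sup>2 / 2) \<le> cell_sign r t * (g r * e t)"
      using weighted_am_gm[of "1 / 2" "g r" "cell_sign r t * e t"] by (auto simp: cell_sign_def)
  qed
  also have "(\<Sum>r<k. \<Sum>t<2 * k. - ((g r)\<^sup>2 / 2 + (e t)\<^sup>2 / 2))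
      = - (k * (k - s\<^sup>2 / k) + k / 2 * (2 * k - S\<^sup>2 / (2 * k)))"
    unfolding g2[symmetric] e2[symmetric]
    by (simp add: sum_negf sum.distrib sum_subtractf flip: sum_divide_distrib)
      (simp flip: sum_distrib_left add: algebra_simps)
  finally have 1: "(\<Sum>r<k. \<Sum>t<2 * k. cell_sign r t * (g r * e t))
      \<ge> - (k * (k - s\<^sup>2 / k) + k / 2 * (2 * k - S\<^sup>2 / (2 * k)))" .
  have 2: "(\<Sum>r<k. g r * (b * ?row r))
      \<ge> - (k * P / 12 * (k - s\<^sup>2 / k)) - 3 * b\<^sup>2 / (k * P) * (\<Sum>r<k. (?row r)\<^sup>2)"
    unfolding g2[symmetric]
    using sum_weighted_am_gm[of "k * P / 12" g "{..<k}" b ?row] k P by (simp add: mult_ac)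
  have "3 * b\<^sup>2 / (k * P) * (\<Sum>r<k. (?row r)\<^sup>2) \<le> 3 * b\<^sup>2 / (k * P) * (4 / 3 * real k ^ 3)"
    using k P sum_cell_sign_row_squares by (intro mult_left_mono) auto
  also have "\<dots> = S\<^sup>2 / P"
    unfolding b[symmetric] using k P by (simp add: power2_eq_square power3_eq_cube field_simps)
  finally have 3: "3 * b\<^sup>2 / (k * P) * (\<Sum>r<k. (?row r)\<^sup>2) \<le> S\<^sup>2 / P" .
  have "(\<Sum>t<2 * k. e t * (a * ?col t))
      \<ge> - (k * Q / 24 * (2 * k - S\<^sup>2 / (2 * k))) - 6 * a\<^sup>2 / (k * Q) * (2 / 3 * real k ^ 3 + 4 / 3 * real k)"
    unfolding e2[symmetric] sum_cell_sign_col_squares[symmetric]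
    using sum_weighted_am_gm[of "k * Q / 24" e "{..<2 * k}" a ?col] k Q by (simp add: mult_ac)
  also have "6 * a\<^sup>2 / (k * Q) * (2 / 3 * real k ^ 3 + 4 / 3 * real k) = 4 * s\<^sup>2 / Q + 8 * a\<^sup>2 / Q"
    unfolding a[symmetric] using k Q by (simp add: power2_eq_square power3_eq_cube field_simps)
  finally have 4: "(\<Sum>t<2 * k. e t * (a * ?col t))
      \<ge> - (k * Q / 24 * (2 * k - S\<^sup>2 / (2 * k))) - (4 * s\<^sup>2 / Q + 8 * a\<^sup>2 / Q)" .
  have "0 \<le> k - s\<^sup>2 / k" unfolding g2[symmetric] by (intro sum_nonneg) simp
  then have "a\<^sup>2 \<le> 1" using k by (simp add: a_def power2_eq_square field_simps)
  then have 5: "8 * a\<^sup>2 / Q \<le> 8 / Q" using Q by (simp add: divide_right_mono)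
  have "- 2 * (real k)\<^sup>2 * (1 + (P + Q) / 24) + (1 + P / 12 - 4 / Q) * s\<^sup>2
        + (1 / 4 + Q / 48 - 1 / P) * S\<^sup>2 - 8 / Q
     = - (k * (k - s\<^sup>2 / k) + k / 2 * (2 * k - S\<^sup>2 / (2 * k)))
       - (k * P / 12 * (k - s\<^sup>2 / k)) - S\<^sup>2 / P
       - (k * Q / 24 * (2 * k - S\<^sup>2 / (2 * k))) - (4 * s\<^sup>2 / Q + 8 / Q)"
    using k P Q by (simp add: power2_eq_square field_simps)
  then show ?thesis unfolding expand using 1 2 3 4 5 by linarith
qed

section \<open>Averaging over blocks\<close>

text \<open>Twice the average of the indicator of \<open>j \<le> 2 * i\<close> over block \<open>u\<close> and block \<open>v\<close>, where the average of
the two blocks \<open>2 * u\<close> and \<open>2 * u + 1\<close> together is used for both of them.\<close>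

definition cell_step :: "nat \<Rightarrow> nat \<Rightarrow> int" where
  "cell_step u v = (if v < 2 * u then 2 else if v < 2 * u + 2 then 1 else 0)"

definition block_sum :: "nat \<Rightarrow> (nat \<Rightarrow> real) \<Rightarrow> nat \<Rightarrow> real" where
  "block_sum k x u = (\<Sum>r<k. x (u * k + r))"

lemma sum_lessThan_add:
  fixes f :: "nat \<Rightarrow> real"
  shows "(\<Sum>i<a + b. f i) = (\<Sum>i<a. f i) + (\<Sum>r<b. f (a + r))"
  by (induction b) (auto simp: add.assoc)

lemma sum_blocks:
  fixes f :: "nat \<Rightarrow> real"
  shows "(\<Sum>i<m * k. f i) = (\<Sum>u<m. \<Sum>r<k. f (u * k + r))"
  by (induction m) (auto simp: add.commute[of k] sum_lessThan_add)

lemma sum_even_odd: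
  fixes g :: "nat \<Rightarrow> real"
  shows "(\<Sum>v<2 * m. g v) = (\<Sum>w<m. g (2 * w) + g (2 * w + 1))"
  by (induction m) auto

text \<open>Below, \<open>B u v\<close> is the contribution of two blocks and \<open>D u v\<close> its difference from the average. The latter
is nonzero only at the two blocks where \<open>j = 2 * i\<close> is crossed, and there the difference is the kernel.
Blocks beyond the first half are paired only with blocks to the left of the crossing.\<close>

lemma below_double_blocks:
  "below_double (2 * h * k) x
     = (\<Sum>u<2 * h. \<Sum>v<2 * h. real_of_int (cell_step u v) / 2 * (block_sum k x u * block_sum k x v))
       + (\<Sum>u<h. \<Sum>r<k. \<Sum>t<2 * k. cell_sign r t * (x (u * k + r) * x (2 * u * k + t))) / 2"
proof -
  let ?s = "block_sum k x"
  define B where "B u v = (\<Sum>r<k. \<Sum>t<k. if v * k + t \<le> 2 * (u * k + r) then x (u * k + r) * x (v * k + t) else 0)" for u v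
  define D where "D u v = B u v - real_of_int (cell_step u v) / 2 * (?s u * ?s v)" for u v
  have full: "?s u * ?s v = (\<Sum>r<k. \<Sum>t<k. x (u * k + r) * x (v * k + t))" for u v
    by (simp add: block_sum_def sum_product)
  have left: "D u v = 0" if "v < 2 * u" for u v
  proof -
    have "v * k + k \<le> 2 * u * k" using mult_le_mono1[of "Suc v" "2 * u" k] that by simp
    then have "B u v = ?s u * ?s v" 
      unfolding full B_def by (intro sum.cong refl) (auto simp: algebra_simps)
    then show ?thesis using that by (simp add: D_def cell_step_def)
  qed
  have right: "D u v = 0" if "2 * u + 1 < v" for u v
  proof -
    have "2 * u * k + 2 * k \<le> v * k" using mult_le_mono1[of "2 * u + 2" v k] that by simp
    then have "B u v = 0" 
      unfolding B_def by (intro sum.neutral ballI) (auto simp: algebra_simps)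
    then show ?thesis using that by (simp add: D_def cell_step_def)
  qed
  have diag: "D u (2 * u) + D u (2 * u + 1)
     = (\<Sum>r<k. \<Sum>t<2 * k. cell_sign r t * (x (u * k + r) * x (2 * u * k + t))) / 2" for u
  proof -
    have "B u (2 * u) + B u (2 * u + 1)
       = (\<Sum>r<k. \<Sum>t<k + k. if t \<le> 2 * r then x (u * k + r) * x (2 * u * k + t) else 0)"
      unfolding B_def sum_lessThan_add sum.distrib[symmetric]
      by (intro sum.cong arg_cong2[of _ _ _ _ "(+)"] refl) (auto simp: algebra_simps)
    moreover have "?s u * (?s (2 * u) + ?s (2 * u + 1)) = (\<Sum>r<k. \<Sum>t<k + k. x (u * k + r) * x (2 * u * k + t))"
      unfolding sum_lessThan_add distrib_left full sum.distrib[symmetric]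
      by (intro sum.cong arg_cong2[of _ _ _ _ "(+)"] refl) (auto simp: algebra_simps)
    moreover have "(\<Sum>r<k. \<Sum>t<k + k. if t \<le> 2 * r then x (u * k + r) * x (2 * u * k + t) else 0)
        = (\<Sum>r<k. \<Sum>t<k + k. x (u * k + r) * x (2 * u * k + t)) / 2
          + (\<Sum>r<k. \<Sum>t<k + k. cell_sign r t * (x (u * k + r) * x (2 * u * k + t))) / 2"
      unfolding sum_divide_distrib sum.distrib[symmetric]
      by (intro sum.cong refl) (auto simp: cell_sign_def)
    moreover have "cell_step u (2 * u) = 1" "cell_step u (2 * u + 1) = 1" by (auto simp: cell_step_def)
    ultimately show ?thesis
      unfolding D_def mult_2[of k] by (simp only: of_int_1 distrib_left)
  qed
  have row: "(\<Sum>v<2 * h. D u v) = (if u < h then D u (2 * u) + D u (2 * u + 1) else 0)" for u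
  proof -
    have zero: "D u (2 * w) + D u (2 * w + 1) = (if w = u then D u (2 * u) + D u (2 * u + 1) else 0)" for w
    proof (cases w u rule: linorder_cases)
      case less
      then have "2 * w < 2 * u" "2 * w + 1 < 2 * u" by auto
      with less show ?thesis by (simp only: left) simp
    next
      case greater
      then have "2 * u + 1 < 2 * w" "2 * u + 1 < 2 * w + 1" by auto
      with greater show ?thesis by (simp only: right) simp
    qed simp
    have "(\<Sum>v<2 * h. D u v) = (\<Sum>w<h. if w = u then D u (2 * u) + D u (2 * u + 1) else 0)"
      unfolding sum_even_odd by (rule sum.cong[OF refl zero])
    then show ?thesis by simp
  qed
  have "below_double (2 * h * k) x = (\<Sum>u<2 * h. \<Sum>v<2 * h. B u v)"
    unfolding below_double_def sum_blocks[where m = "2 * h" and k = k] B_def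
    by (rule sum.cong[OF refl sum.swap])
  also have "\<dots> = (\<Sum>u<2 * h. \<Sum>v<2 * h. real_of_int (cell_step u v) / 2 * (?s u * ?s v))
      + (\<Sum>u<2 * h. \<Sum>v<2 * h. D u v)"
    unfolding sum.distrib[symmetric] by (simp add: D_def)
  also have "(\<Sum>u<2 * h. \<Sum>v<2 * h. D u v) = (\<Sum>u<h. D u (2 * u) + D u (2 * u + 1))"
    unfolding row by (rule sum.mono_neutral_cong_right) auto
  finally show ?thesis
    by (simp only: diag sum_divide_distrib)
qed

lemma below_double_ge:
  fixes P Q :: "nat \<Rightarrow> real"
  assumes "0 < k" and x: "\<And>i. (x i)\<^sup>2 = 1" and PQ: "\<And>u. u < h \<Longrightarrow> 0 < P u \<and> 1 \<le> Q u"
  defines "s \<equiv> block_sum k x"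
  shows "below_double (2 * h * k) x
    \<ge> (\<Sum>u<2 * h. \<Sum>v<2 * h. real_of_int (cell_step u v) / 2 * (s u * s v))
      + (\<Sum>u<h. (1 / 2 + P u / 24 - 2 / Q u) * (s u)\<^sup>2
               + (1 / 8 + Q u / 96 - 1 / (2 * P u)) * (s (2 * u) + s (2 * u + 1))\<^sup>2)
      - (real k)\<^sup>2 * (\<Sum>u<h. 1 + (P u + Q u) / 24) - 4 * real h"
proof -
  have "(\<Sum>u<h. - 2 * (real k)\<^sup>2 * (1 + (P u + Q u) / 24) + (1 + P u / 12 - 4 / Q u) * (s u)\<^sup>2
        + (1 / 4 + Q u / 48 - 1 / P u) * (s (2 * u) + s (2 * u + 1))\<^sup>2 - 8)
      \<le> (\<Sum>u<h. \<Sum>r<k. \<Sum>t<2 * k. cell_sign r t * (x (u * k + r) * x (2 * u * k + t)))"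
  proof (rule sum_mono)
    fix u assume "u \<in> {..<h}"
    then have PQ': "0 < P u" "0 < Q u" "1 \<le> Q u" using PQ[of u] by auto
    have "(\<Sum>t<2 * k. x (2 * u * k + t)) = s (2 * u) + s (2 * u + 1)"
      by (simp only: s_def block_sum_def mult_2[of k] sum_lessThan_add) (simp add: algebra_simps)
    moreover have "8 / Q u \<le> 8" using PQ' by (simp add: divide_le_eq)
    ultimately show "- 2 * (real k)\<^sup>2 * (1 + (P u + Q u) / 24) + (1 + P u / 12 - 4 / Q u) * (s u)\<^sup>2
        + (1 / 4 + Q u / 48 - 1 / P u) * (s (2 * u) + s (2 * u + 1))\<^sup>2 - 8
      \<le> (\<Sum>r<k. \<Sum>t<2 * k. cell_sign r t * (x (u * k + r) * x (2 * u * k + t)))"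
      using cell_sum_ge[OF assms(1), of "\<lambda>r. x (u * k + r)" "\<lambda>t. x (2 * u * k + t)", OF x x PQ'(1,2)]
      by (simp add: s_def block_sum_def)
  qed
  moreover have "(\<Sum>u<h. - 2 * (real k)\<^sup>2 * (1 + (P u + Q u) / 24) + (1 + P u / 12 - 4 / Q u) * (s u)\<^sup>2
        + (1 / 4 + Q u / 48 - 1 / P u) * (s (2 * u) + s (2 * u + 1))\<^sup>2 - 8) / 2
    = (\<Sum>u<h. (1 / 2 + P u / 24 - 2 / Q u) * (s u)\<^sup>2
               + (1 / 8 + Q u / 96 - 1 / (2 * P u)) * (s (2 * u) + s (2 * u + 1))\<^sup>2)
      - (real k)\<^sup>2 * (\<Sum>u<h. 1 + (P u + Q u) / 24) - 4 * real h"
  proof -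
    have four: "4 * real h = (\<Sum>u<h. 4)" by simp
    show ?thesis
      unfolding four sum_distrib_left sum_divide_distrib sum_subtractf[symmetric]
      by (intro sum.cong refl) (simp add: algebra_simps add_divide_distrib diff_divide_distrib)
  qed
  ultimately show ?thesis
    unfolding below_double_blocks s_def[symmetric] by linarith
qed

section \<open>A rounded elimination test for positive semidefinite integer matrices\<close>

text \<open>A symmetric matrix is stored as the list of its rows from the diagonal on. After the pivot \<open>p\<close> with
the rest \<open>r\<close> of its row is eliminated, the Schur complement \<open>m - a * b / p\<close> is not integral. Entries
are rounded, and \<open>c\<close> is subtracted on the diagonal to pay for all rounding errors, so that integers of
bounded size suffice throughout.\<close>

fun rounded_schur :: "int \<Rightarrow> int \<Rightarrow> int list \<Rightarrow> int list list \<Rightarrow> int list list" where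
  "rounded_schur c p (a # r) ((m # ms) # rows) =
     ((m - a * a div p - c) # map2 (\<lambda>b m'. m' - a * b div p) r ms) # rounded_schur c p r rows"
| "rounded_schur c p _ _ = []"

lemma length_rounded_schur: "length (rounded_schur c p r rows) \<le> length rows"
  by (induction c p r rows rule: rounded_schur.induct) auto

text \<open>The number of remaining variables is a sufficient allowance \<open>c\<close>: every entry changes by less
than \<open>1\<close>, so that this number bounds the absolute row sums of the error matrix.\<close>

function eliminates :: "int list list \<Rightarrow> bool" where
  "eliminates [] = True"
| "eliminates ([] # rows) = False"
| "eliminates ((p # r) # rows) = (0 < p \<and> eliminates (rounded_schur (int (length r)) p r rows))"
  by pat_completeness auto
termination by (relation "measure length") (auto simp: length_rounded_schur less_Suc_eq_le)

definition dot :: "int list \<Rightarrow> real list \<Rightarrow> real" where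
  "dot r xs = (\<Sum>(a, x)\<leftarrow>zip r xs. real_of_int a * x)"

fun upper_form :: "int list list \<Rightarrow> real list \<Rightarrow> real" where
  "upper_form ((p # r) # rows) (x # xs) = real_of_int p * x\<^sup>2 + 2 * x * dot r xs + upper_form rows xs"
| "upper_form _ _ = 0"

fun upper_triangular :: "int list list \<Rightarrow> bool" where
  "upper_triangular [] = True"
| "upper_triangular (r # rows) = (length r = Suc (length rows) \<and> upper_triangular rows)"

lemma dot_simps [simp]: "dot [] xs = 0" "dot r [] = 0"
  "dot (a # r) (x # xs) = real_of_int a * x + dot r xs"
  by (simp_all add: dot_def)

lemma upper_triangular_rounded_schur: "length r = length rows \<Longrightarrow> upper_triangular rows \<Longrightarrow>
   length (rounded_schur c p r rows) = length rows \<and> upper_triangular (rounded_schur c p r rows)"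
  by (induction c p r rows rule: rounded_schur.induct) auto

lemma of_int_div_bounds:
  fixes a p :: int
  shows "real_of_int (a div p) \<le> a / p" "a / p \<le> real_of_int (a div p) + 1"
  unfolding floor_divide_of_int_eq[symmetric, where ?'a = real] by linarith+

text \<open>Each rounding error \<open>d\<close> lies between \<open>0\<close> and \<open>1\<close>, so \<open>2 * x * (d * y) \<le> x^2 + y^2\<close>. The error
of an off-diagonal entry is thus charged to the two diagonal entries that belong to it.\<close>

lemma rounding_row:
  fixes x :: real
  assumes "0 < p" "length ms = length r" "length xs = length r"
  shows "2 * x * (dot (map2 (\<lambda>b m. m - a * b div p) r ms) xs)
           \<le> 2 * x * (dot ms xs - real_of_int a * dot r xs / p) + length xs * x\<^sup>2 + (\<Sum>y\<leftarrow>xs. y\<^sup>2)"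
  using assms(2,3)
proof (induction r arbitrary: ms xs)
  case (Cons b r)
  obtain m ms' y ys where eq: "ms = m # ms'" "xs = y # ys"
    using Cons.prems by (metis length_Suc_conv)
  define d where "d = real_of_int (a * b) / p - real_of_int (a * b div p)"
  have "0 \<le> d" "d \<le> 1"
    using of_int_div_bounds[of "a * b" p] by (auto simp: d_def)
  then have "d\<^sup>2 \<le> 1" by (simp add: power_le_one)
  then have "d\<^sup>2 * y\<^sup>2 \<le> 1 * y\<^sup>2" by (rule mult_right_mono) simp
  moreover have "0 \<le> (x - d * y)\<^sup>2" by simp
  ultimately have "2 * x * (d * y) \<le> x\<^sup>2 + y\<^sup>2"
    by (simp add: power2_eq_square algebra_simps)
  moreover have "2 * x * (dot (map2 (\<lambda>b m. m - a * b div p) r ms') ys)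
    \<le> 2 * x * (dot ms' ys - real_of_int a * dot r ys / p) + length ys * x\<^sup>2 + (\<Sum>y\<leftarrow>ys. y\<^sup>2)"
    using Cons eq by auto
  ultimately show ?case
    by (simp add: eq d_def algebra_simps add_divide_distrib)
qed simp

text \<open>The second summand on the left is the part of the allowance \<open>c\<close> that the rounding leaves over.
It is needed for the induction, which peels off one row and charges \<open>1\<close> to each later variable.\<close>

lemma upper_form_rounded_schur:
  assumes "0 < p" "length r = length rows" "length xs = length rows" "upper_triangular rows" "int (length xs) \<le> c"
  shows "upper_form (rounded_schur c p r rows) xs + (real_of_int c - length xs) * (\<Sum>y\<leftarrow>xs. y\<^sup>2)
           \<le> upper_form rows xs - (dot r xs)\<^sup>2 / p"
  using assms(2-)
proof (induction rows arbitrary: r xs)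
  case (Cons row rows)
  obtain a r' m ms x xs' where eq: "r = a # r'" "row = m # ms" "xs = x # xs'"
    using Cons.prems by (metis length_Suc_conv upper_triangular.simps(2))
  have IH: "upper_form (rounded_schur c p r' rows) xs' + (real_of_int c - length xs') * (\<Sum>y\<leftarrow>xs'. y\<^sup>2)
           \<le> upper_form rows xs' - (dot r' xs')\<^sup>2 / p"
    using Cons by (auto simp: eq)
  have row: "2 * x * (dot (map2 (\<lambda>b m. m - a * b div p) r' ms) xs')
           \<le> 2 * x * (dot ms xs' - real_of_int a * dot r' xs' / p) + length xs' * x\<^sup>2 + (\<Sum>y\<leftarrow>xs'. y\<^sup>2)"
    by (rule rounding_row) (use Cons.prems assms(1) in \<open>auto simp: eq\<close>)
  have "real_of_int (a * a) / p - 1 \<le> real_of_int (a * a div p)"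
    using of_int_div_bounds(2)[of "a * a" p] by simp
  then have "(real_of_int (a * a) / p - 1) * x\<^sup>2 \<le> real_of_int (a * a div p) * x\<^sup>2"
    by (rule mult_right_mono) simp
  then show ?case
    using IH row unfolding eq
    by (simp add: power2_eq_square algebra_simps add_divide_distrib)
qed simp

text \<open>Completing the square in the pivot variable leaves the exact Schur complement, which is at least the
rounded one.\<close>

lemma eliminates_imp_nonneg:
  "eliminates rows \<Longrightarrow> upper_triangular rows \<Longrightarrow> length xs = length rows \<Longrightarrow> 0 \<le> upper_form rows xs"
proof (induction rows arbitrary: xs rule: eliminates.induct)
  case (3 p r rows)
  obtain x xs' where eq: "xs = x # xs'" using "3.prems" by (metis length_Suc_conv)
  let ?S = "rounded_schur (int (length r)) p r rows"
  have p: "0 < p" and S: "eliminates ?S" and len: "length r = length rows" "length xs' = length rows" "upper_triangular rows"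
    using "3.prems" by (auto simp: eq)
  have "0 \<le> upper_form ?S xs'"
    using "3.IH" p S len upper_triangular_rounded_schur[OF len(1,3)] by auto
  also have "upper_form ?S xs' \<le> upper_form rows xs' - (dot r xs')\<^sup>2 / p"
    using upper_form_rounded_schur[OF p len(1,2,3), of "int (length r)"] len by simp
  finally have "0 \<le> upper_form rows xs' - (dot r xs')\<^sup>2 / p" .
  moreover have "0 \<le> (real_of_int p * x + dot r xs')\<^sup>2 / p"
    using p by simp
  moreover have "(real_of_int p * x + dot r xs')\<^sup>2 / p = p * x\<^sup>2 + 2 * x * dot r xs' + (dot r xs')\<^sup>2 / p"
    using p by (simp add: power2_eq_square field_simps)
  ultimately show ?case by (simp add: eq)
qed auto

definition upper_rows :: "(nat \<Rightarrow> nat \<Rightarrow> int) \<Rightarrow> nat \<Rightarrow> nat \<Rightarrow> int list list" where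
  "upper_rows f m n = map (\<lambda>u. map (f u) [u..<n]) [m..<n]"

lemma dot_map: "dot (map f [m..<n]) (map x [m..<n]) = (\<Sum>v\<in>{m..<n}. f v * x v)"
  by (simp add: dot_def zip_map_map interv_sum_list_conv_sum_set_nat zip_same_conv_map comp_def)

lemma upper_rows_step: "m < n \<Longrightarrow> upper_rows f m n = (f m m # map (f m) [Suc m..<n]) # upper_rows f (Suc m) n"
  by (simp add: upper_rows_def upt_conv_Cons)

lemma upper_triangular_upper_rows: "m \<le> n \<Longrightarrow> upper_triangular (upper_rows f m n) \<and> length (upper_rows f m n) = n - m"
proof (induction m rule: inc_induct)
  case (step k)
  then show ?case by (simp add: upper_rows_step Suc_diff_le)
qed (simp add: upper_rows_def)

lemma upper_form_upper_rows:
  assumes "\<And>u v. f u v = f v u" "m \<le> n"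
  shows "upper_form (upper_rows f m n) (map x [m..<n]) = (\<Sum>u\<in>{m..<n}. \<Sum>v\<in>{m..<n}. f u v * x u * x v)"
  using assms(2)
proof (induction m rule: inc_induct)
  case (step k)
  have split: "(\<Sum>u\<in>{k..<n}. g u) = g k + (\<Sum>u\<in>{Suc k..<n}. g u)" for g :: "nat \<Rightarrow> real"
    using step.hyps by (simp add: sum.atLeast_Suc_lessThan)
  have sym: "(\<Sum>u\<in>{Suc k..<n}. f u k * x u * x k) = (\<Sum>u\<in>{Suc k..<n}. f k u * x k * x u)"
    by (rule sum.cong) (auto simp: assms(1)[of _ k])
  have "map x [k..<n] = x k # map x [Suc k..<n]" using step.hyps by (simp add: upt_conv_Cons)
  then show ?case
    using step by (simp add: upper_rows_step dot_map split sum.distrib sym)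
      (simp add: sum_distrib_left algebra_simps power2_eq_square)
qed (simp add: upper_rows_def)

lemma upper_rows_form_nonneg:
  assumes "\<And>u v. f u v = f v u" "eliminates (upper_rows f 0 n)"
  shows "0 \<le> (\<Sum>u<n. \<Sum>v<n. real_of_int (f u v) * x u * x v)"
  using eliminates_imp_nonneg[OF assms(2), of "map x [0..<n]"] upper_triangular_upper_rows[of 0 n f] upper_form_upper_rows[of f 0 n x, OF assms(1)]
  by (simp add: atLeast0LessThan)

section \<open>Quadratic forms and reflection\<close>

definition quadratic_form :: "nat \<Rightarrow> (nat \<Rightarrow> nat \<Rightarrow> int) \<Rightarrow> (nat \<Rightarrow> real) \<Rightarrow> real" where
  "quadratic_form n f s = (\<Sum>u<n. \<Sum>v<n. real_of_int (f u v) * s u * s v)"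

text \<open>The matrix of the restriction to vectors that are even (\<open>\<epsilon> = 1\<close>) or odd (\<open>\<epsilon> = -1\<close>) under reflection,
in terms of the first \<open>h\<close> coordinates out of \<open>2 * h\<close>.\<close>

definition folded :: "nat \<Rightarrow> int \<Rightarrow> (nat \<Rightarrow> nat \<Rightarrow> int) \<Rightarrow> nat \<Rightarrow> nat \<Rightarrow> int" where
  "folded h \<epsilon> f u v = (let u' = 2 * h - 1 - u; v' = 2 * h - 1 - v in
     f u v + \<epsilon> * (f u v' + f u' v) + f u' v')"

lemma sum_fold:
  fixes g :: "nat \<Rightarrow> real"
  shows "(\<Sum>u<2 * h. g u) = (\<Sum>u<h. g u + g (2 * h - 1 - u))"
proof -
  have "(\<Sum>r<h. g (h + r)) = (\<Sum>u<h. g (2 * h - 1 - u))"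
    using sum.nat_diff_reindex[of "\<lambda>r. g (h + r)" h, symmetric]
    by (rule trans) (auto intro!: sum.cong arg_cong[of _ _ g])
  then show ?thesis by (simp add: mult_2 sum_lessThan_add sum.distrib)
qed

lemma quadratic_form_folded:
  fixes s :: "nat \<Rightarrow> real"
  assumes "\<And>u. u < h \<Longrightarrow> s (2 * h - 1 - u) = \<epsilon> * s u" "\<epsilon> * \<epsilon> = (1 :: int)"
  shows "quadratic_form (2 * h) f s = quadratic_form h (folded h \<epsilon> f) s"
  unfolding quadratic_form_def sum_fold
proof (intro sum.cong refl)
  fix u assume "u \<in> {..<h}"
  have ee: "real_of_int \<epsilon> * real_of_int \<epsilon> = 1" using assms(2) by (metis of_int_1 of_int_mult)
  have eps: "real_of_int \<epsilon> * (real_of_int \<epsilon> * c) = c" for c using ee by (simp flip: mult.assoc)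
  show "(\<Sum>v<h. real_of_int (f u v) * s u * s v + real_of_int (f u (2 * h - 1 - v)) * s u * s (2 * h - 1 - v))
     + (\<Sum>v<h. real_of_int (f (2 * h - 1 - u) v) * s (2 * h - 1 - u) * s v
         + real_of_int (f (2 * h - 1 - u) (2 * h - 1 - v)) * s (2 * h - 1 - u) * s (2 * h - 1 - v))
     = (\<Sum>v<h. real_of_int (folded h \<epsilon> f u v) * s u * s v)"
    unfolding sum.distrib[symmetric]
  proof (intro sum.cong refl)
    fix v assume "v \<in> {..<h}"
    with \<open>u \<in> {..<h}\<close> have R: "s (2 * h - 1 - u) = \<epsilon> * s u" "s (2 * h - 1 - v) = \<epsilon> * s v"
      using assms(1) by auto
    show "real_of_int (f u v) * s u * s v + real_of_int (f u (2 * h - 1 - v)) * s u * s (2 * h - 1 - v)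
     + (real_of_int (f (2 * h - 1 - u) v) * s (2 * h - 1 - u) * s v
         + real_of_int (f (2 * h - 1 - u) (2 * h - 1 - v)) * s (2 * h - 1 - u) * s (2 * h - 1 - v))
     = real_of_int (folded h \<epsilon> f u v) * s u * s v"
      by (simp only: folded_def Let_def R of_int_add of_int_mult) (simp add: algebra_simps eps)
  qed
qed

text \<open>With \<open>e\<close> the even and \<open>d\<close> the odd part of \<open>s\<close>, both doubled, the sum of the two values is half the sum of
the values at \<open>e\<close> and \<open>d\<close> by the parallelogram law.\<close>

lemma reflected_forms_nonneg:
  assumes "\<And>\<epsilon> t. \<epsilon> \<in> {1, -1} \<Longrightarrow> 0 \<le> quadratic_form h (folded h \<epsilon> f) t"
  shows "0 \<le> quadratic_form (2 * h) f s + quadratic_form (2 * h) f (\<lambda>u. s (2 * h - 1 - u))"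
proof -
  let ?R = "\<lambda>u. s (2 * h - 1 - u)"
  define e where "e u = s u + ?R u" for u
  define d where "d u = s u - ?R u" for u
  have "quadratic_form (2 * h) f e = quadratic_form h (folded h 1 f) e"
    by (rule quadratic_form_folded) (auto simp: e_def)
  moreover have "quadratic_form (2 * h) f d = quadratic_form h (folded h (-1) f) d"
    by (rule quadratic_form_folded) (auto simp: d_def)
  moreover have "quadratic_form (2 * h) f e + quadratic_form (2 * h) f d
      = 2 * (quadratic_form (2 * h) f s + quadratic_form (2 * h) f ?R)"
    unfolding quadratic_form_def sum.distrib[symmetric] sum_distrib_left
    by (intro sum.cong refl) (simp add: e_def d_def algebra_simps)
  ultimately show ?thesis
    using assms[of 1 e] assms[of "-1" d] by simp
qed

section \<open>The block form and the lower bound\<close>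

text \<open>One pair of AM-GM weights for each block of the left half. They are a rounded solution of the
semidefinite program that maximizes the least eigenvalue of the resulting forms subject to a bound on the
total of the weights, which determines the constant term. The attainable bound improves with the number of blocks,
because the loss in AM-GM shrinks; 72 blocks leave a small margin.\<close>

definition cell_weights :: "(int \<times> int) list" where
  "cell_weights =
    [(19, 14), (7, 7), (10, 8), (6, 3), (6, 3), (11, 10), (15, 10), (15, 12), (15, 22),
     (17, 23), (18, 24), (16, 34), (15, 39), (16, 43), (12, 32), (27, 42), (25, 39), (43, 23),
     (40, 23), (43, 40), (39, 43), (47, 38), (52, 47), (65, 43), (74, 37), (76, 26), (69, 25),
     (51, 25), (47, 13), (36, 11), (30, 12), (45, 11), (42, 13), (34, 8), (33, 8), (23, 14)]"

definition small_weight :: "nat \<Rightarrow> int" where "small_weight u = fst (cell_weights ! u)"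
definition large_weight :: "nat \<Rightarrow> int" where "large_weight u = snd (cell_weights ! u)"

text \<open>All but the last term is the lower bound for \<open>T x\<close> in lemma \<open>below_double_ge\<close> without its
constants. The term \<open>- 3/4 S^2\<close> is shared equally between \<open>x\<close> and its reflection.\<close>

definition block_form :: "(nat \<Rightarrow> real) \<Rightarrow> real" where
  "block_form s = (\<Sum>u<72. \<Sum>v<72. real_of_int (cell_step u v) / 2 * (s u * s v))
      + (\<Sum>u<36. (1 / 2 + small_weight u / 24 - 2 / large_weight u) * (s u)\<^sup>2
               + (1 / 8 + large_weight u / 96 - 1 / (2 * small_weight u)) * (s (2 * u) + s (2 * u + 1))\<^sup>2)
      - 3 / 8 * (\<Sum>u<72. s u)\<^sup>2"

text \<open>This is the matrix of \<open>19200 * block_form\<close>, with the coefficients of the squares rounded down.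
The factor \<open>19200 = 8 * 2400\<close> clears the denominators \<open>8\<close>, \<open>24\<close> and \<open>96\<close> and is large enough for the
rounding here and in the elimination to stay below the least eigenvalue. The off-diagonal part is
symmetrized because the elimination reads only half of the matrix.\<close>

definition block_matrix :: "nat \<Rightarrow> nat \<Rightarrow> int" where
  "block_matrix u v = 2400 * (2 * cell_step u v + 2 * cell_step v u - 3)
     + (if u = v \<and> u < 36 then 9600 + 800 * small_weight u + 8 * ((-4800) div large_weight u) else 0)
     + (if u div 2 = v div 2 then 2400 + 200 * large_weight (u div 2) + 2 * ((-4800) div small_weight (u div 2)) else 0)"

lemma cell_weights_pos: "u < 36 \<Longrightarrow> 0 < small_weight u \<and> 0 < large_weight u"
proof -
  assume "u < 36"
  then have "cell_weights ! u \<in> set cell_weights" by (intro nth_mem) (simp add: cell_weights_def)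
  moreover have "\<forall>(p, q)\<in>set cell_weights. 0 < p \<and> 0 < q" by (simp add: cell_weights_def)
  ultimately show ?thesis by (auto simp: small_weight_def large_weight_def split_def)
qed

lemma sum_cell_weights: "(\<Sum>u<36. 1 + (real_of_int (small_weight u) + large_weight u) / 24) = 707 / 6"
proof -
  have "length cell_weights = 36" "(\<Sum>(p, q)\<leftarrow>cell_weights. p + q) = 1964"
    by (simp_all add: cell_weights_def)
  then have "(\<Sum>u<36. small_weight u + large_weight u) = 1964"
    by (simp add: sum_list_sum_nth small_weight_def large_weight_def split_def atLeast0LessThan)
  then have "(\<Sum>u<36. real_of_int (small_weight u) + large_weight u) = 1964"
    by (simp flip: of_int_add of_int_sum)
  then show ?thesis by (simp add: sum.distrib flip: sum_divide_distrib)
qed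

lemma block_matrix_sym: "block_matrix u v = block_matrix v u"
  by (auto simp: block_matrix_def)

lemma folded_block_matrix_sym: "folded h \<epsilon> block_matrix u v = folded h \<epsilon> block_matrix v u"
  by (simp add: folded_def Let_def block_matrix_sym algebra_simps)

lemma block_matrix_le_block_form: "quadratic_form 72 block_matrix s \<le> 19200 * block_form s"
proof -
  define c where "c u = 9600 + 800 * small_weight u + 8 * ((-4800) div large_weight u)" for u
  define d where "d u = 2400 + 200 * large_weight u + 2 * ((-4800) div small_weight u)" for u
  let ?E = "\<Sum>u<72. \<Sum>v<72. real_of_int (cell_step u v) * (s u * s v)"
  have square: "(\<Sum>u<72. s u)\<^sup>2 = (\<Sum>u<72. \<Sum>v<72. s u * s v)"
    by (simp add: power2_eq_square sum_product)
  have "quadratic_form 72 block_matrix s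
     = (\<Sum>u<72. \<Sum>v<72. 4800 * (real_of_int (cell_step u v) * (s u * s v))
         + 4800 * (real_of_int (cell_step v u) * (s u * s v)) - 7200 * (s u * s v)
         + (if u = v then if u < 36 then real_of_int (c u) * (s u)\<^sup>2 else 0 else 0)
         + (if u div 2 = v div 2 then real_of_int (d (u div 2)) * (s u * s v) else 0))"
    unfolding quadratic_form_def block_matrix_def c_def[symmetric] d_def[symmetric]
    by (intro sum.cong refl) (simp add: algebra_simps power2_eq_square)
  also have "\<dots> = 4800 * ?E + 4800 * (\<Sum>u<72. \<Sum>v<72. real_of_int (cell_step v u) * (s u * s v))
      - 7200 * (\<Sum>u<72. s u)\<^sup>2
      + (\<Sum>u<72. if u < 36 then real_of_int (c u) * (s u)\<^sup>2 else 0)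
      + (\<Sum>u<72. \<Sum>v<72. if u div 2 = v div 2 then real_of_int (d (u div 2)) * (s u * s v) else 0)"
    by (simp add: sum.distrib sum_subtractf sum_distrib_left square)
  also have "(\<Sum>u<72. \<Sum>v<72. real_of_int (cell_step v u) * (s u * s v)) = ?E"
    by (subst sum.swap) (simp add: mult.commute[of "s _" "s _"])
  also have "(\<Sum>u<72. if u < 36 then real_of_int (c u) * (s u)\<^sup>2 else 0) = (\<Sum>u<36. c u * (s u)\<^sup>2)"
    by (rule sum.mono_neutral_cong_right) auto
  also have "(\<Sum>u<72. \<Sum>v<72. if u div 2 = v div 2 then real_of_int (d (u div 2)) * (s u * s v) else 0)
      = (\<Sum>u<36. d u * (s (2 * u) + s (2 * u + 1))\<^sup>2)"
  proof -
    have "(\<Sum>v<2 * 36. if w = v div 2 then real_of_int (d w) * (y * s v) else 0)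
        = real_of_int (d w) * (y * (s (2 * w) + s (2 * w + 1)))" if "w < 36" for w y
    proof -
      have "(\<Sum>v<2 * 36. if w = v div 2 then real_of_int (d w) * (y * s v) else 0)
          = (\<Sum>w'<36. if w = w' then real_of_int (d w) * (y * (s (2 * w) + s (2 * w + 1))) else 0)"
        unfolding sum_even_odd by (intro sum.cong refl) (auto simp: algebra_simps)
      then show ?thesis using that by simp
    qed
    then have "(\<Sum>u<2 * 36. \<Sum>v<2 * 36. if u div 2 = v div 2 then real_of_int (d (u div 2)) * (s u * s v) else 0)
      = (\<Sum>u<2 * 36. d (u div 2) * (s u * (s (2 * (u div 2)) + s (2 * (u div 2) + 1))))"
      by (intro sum.cong refl) auto
    also have "\<dots> = (\<Sum>u<36. d u * (s (2 * u) + s (2 * u + 1))\<^sup>2)"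
      unfolding sum_even_odd by (intro sum.cong refl) (simp add: power2_eq_square algebra_simps)
    finally show ?thesis by simp
  qed
  finally have eq: "quadratic_form 72 block_matrix s = 9600 * ?E - 7200 * (\<Sum>u<72. s u)\<^sup>2
      + (\<Sum>u<36. c u * (s u)\<^sup>2 + d u * (s (2 * u) + s (2 * u + 1))\<^sup>2)"
    by (simp add: sum.distrib)
  have "(\<Sum>u<36. c u * (s u)\<^sup>2 + d u * (s (2 * u) + s (2 * u + 1))\<^sup>2)
      \<le> (\<Sum>u<36. 19200 * ((1 / 2 + small_weight u / 24 - 2 / large_weight u) * (s u)\<^sup>2
               + (1 / 8 + large_weight u / 96 - 1 / (2 * small_weight u)) * (s (2 * u) + s (2 * u + 1))\<^sup>2))"
  proof (rule sum_mono)
    fix u assume "u \<in> {..<36::nat}"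
    have "c u \<le> 19200 * (1 / 2 + small_weight u / 24 - 2 / large_weight u)"
      using of_int_div_bounds(1)[of "-4800" "large_weight u"] by (simp add: c_def)
    moreover have "d u \<le> 19200 * (1 / 8 + large_weight u / 96 - 1 / (2 * small_weight u))"
      using of_int_div_bounds(1)[of "-4800" "small_weight u"] by (simp add: d_def)
    ultimately have "c u * (s u)\<^sup>2 + d u * (s (2 * u) + s (2 * u + 1))\<^sup>2
      \<le> 19200 * (1 / 2 + small_weight u / 24 - 2 / large_weight u) * (s u)\<^sup>2
        + 19200 * (1 / 8 + large_weight u / 96 - 1 / (2 * small_weight u)) * (s (2 * u) + s (2 * u + 1))\<^sup>2"
      by (intro add_mono mult_right_mono) auto
    then show "c u * (s u)\<^sup>2 + d u * (s (2 * u) + s (2 * u + 1))\<^sup>2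
      \<le> 19200 * ((1 / 2 + small_weight u / 24 - 2 / large_weight u) * (s u)\<^sup>2
               + (1 / 8 + large_weight u / 96 - 1 / (2 * small_weight u)) * (s (2 * u) + s (2 * u + 1))\<^sup>2)"
      by (simp only: distrib_left mult.assoc)
  qed
  moreover have "9600 * ?E = 19200 * (\<Sum>u<72. \<Sum>v<72. real_of_int (cell_step u v) / 2 * (s u * s v))"
    unfolding sum_distrib_left by (intro sum.cong refl) simp
  ultimately show ?thesis
    unfolding eq block_form_def by (simp only: distrib_left right_diff_distrib sum_distrib_left)
qed

lemma eliminates_even_block_matrix: "eliminates (upper_rows (folded 36 1 block_matrix) 0 36)"
  by code_simp
lemma eliminates_odd_block_matrix: "eliminates (upper_rows (folded 36 (-1) block_matrix) 0 36)"
  by code_simp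

lemma block_form_reflected_nonneg: "0 \<le> block_form s + block_form (\<lambda>u. s (71 - u))"
proof -
  have "0 \<le> quadratic_form 36 (folded 36 \<epsilon> block_matrix) t" if "\<epsilon> \<in> {1, -1}" for \<epsilon> t
    using that upper_rows_form_nonneg[OF folded_block_matrix_sym eliminates_even_block_matrix]
      upper_rows_form_nonneg[OF folded_block_matrix_sym eliminates_odd_block_matrix]
    by (auto simp: quadratic_form_def)
  from reflected_forms_nonneg[OF this, of s] 
  show ?thesis
    using block_matrix_le_block_form[of s] block_matrix_le_block_form[of "\<lambda>u. s (71 - u)"] by simp
qed

text \<open>Reflecting the coloring reverses the sequence of block sums, so the two block forms combine to a
nonnegative number and only the constants remain.\<close>

lemma below_double_reflected_ge:
  assumes k: "0 < k" and x: "\<And>i. (x i)\<^sup>2 = (1::real)" and N: "N = 72 * k"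
  shows "below_double N x + below_double N (\<lambda>i. x (N - Suc i)) - 3 / 4 * (\<Sum>i<N. x i)\<^sup>2
     \<ge> - (707 / 3) * (real k)\<^sup>2 - 288"
proof -
  have bound: "below_double N y \<ge> block_form (block_sum k y) + 3 / 8 * (\<Sum>i<N. y i)\<^sup>2 - 707 / 6 * (real k)\<^sup>2 - 144"
    if y: "\<And>i. (y i)\<^sup>2 = 1" for y
  proof -
    have "(\<Sum>i<N. y i) = (\<Sum>u<72. block_sum k y u)"
      unfolding N sum_blocks block_sum_def ..
    moreover have "0 < real_of_int (small_weight u) \<and> 1 \<le> real_of_int (large_weight u)" if "u < 36" for u
      using cell_weights_pos[OF that] by simp
    note below_double_ge[of k y 36 small_weight large_weight, OF k y this]
    ultimately show ?thesis
      unfolding sum_cell_weights by (simp add: block_form_def N)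
  qed
  have reflect: "block_sum k (\<lambda>i. x (N - Suc i)) u = block_sum k x (71 - u)" if "u < 72" for u
  proof -
    have "block_sum k (\<lambda>i. x (N - Suc i)) u = (\<Sum>r<k. x ((71 - u) * k + (k - Suc r)))"
      unfolding block_sum_def
    proof (intro sum.cong refl arg_cong[of _ _ x])
      fix r assume "r \<in> {..<k}"
      then have "Suc r \<le> k" by simp
      have "(71 - u) * k + u * k + k = ((71 - u) + u + 1) * k"
        by (simp only: add_mult_distrib mult_1)
      also have "\<dots> = 72 * k" using that by simp
      finally have "(71 - u) * k + u * k + k = 72 * k" .
      with \<open>Suc r \<le> k\<close> show "N - Suc (u * k + r) = (71 - u) * k + (k - Suc r)" by (simp add: N)
    qed
    also have "\<dots> = block_sum k x (71 - u)"
      unfolding block_sum_def by (rule sum.nat_diff_reindex)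
    finally show ?thesis .
  qed
  have "block_form (block_sum k (\<lambda>i. x (N - Suc i))) = block_form (\<lambda>u. block_sum k x (71 - u))"
  proof -
    have cong: "block_form s = block_form s'" if "\<And>u. u < 72 \<Longrightarrow> s u = s' u" for s s'
      unfolding block_form_def using that by simp
    show ?thesis by (rule cong) (rule reflect)
  qed
  moreover have "(\<Sum>i<N. x (N - Suc i)) = (\<Sum>i<N. x i)" by (rule sum.nat_diff_reindex)
  ultimately show ?thesis
    using bound[of x, OF x] bound[of "\<lambda>i. x (N - Suc i)", OF x] block_form_reflected_nonneg[of "block_sum k x"]
    by simp
qed

text \<open>Only the initial segment of length \<open>72 * (n div 72)\<close> is used. It omits at most 71 elements, which costs
a term linear in \<open>n\<close>; the constant \<open>20\<close> is generous and also covers \<open>n < 72\<close>.\<close>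

lemma mono_ap3_ge:
  assumes "\<chi> \<in> two_colorings n"
  shows "real (card (mono_ap3 n \<chi>)) \<ge> 1675 / 32768 * (real n)\<^sup>2 - 20 * real n"
proof -
  define k where "k = n div 72"
  have n: "72 * k \<le> n" "n < 72 * k + 72" by (auto simp: k_def)
  show ?thesis
  proof (cases "k = 0")
    case True
    then have "real n * real n \<le> 72 * real n" using n by (intro mult_right_mono) auto
    then have "1675 / 32768 * (real n)\<^sup>2 - 20 * real n \<le> 0" by (simp add: power2_eq_square)
    then show ?thesis by (rule order_trans) simp
  next
    case False
    obtain x :: "nat \<Rightarrow> real" where x: "\<And>i. (x i)\<^sup>2 = 1"
      and mono: "4 * real (card (mono_ap3 n \<chi>)) \<ge> real (72 * k) ^ 2 / 4 - 2 * real (72 * k)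
       + below_double (72 * k) x + below_double (72 * k) (\<lambda>i. x (72 * k - Suc i)) - 3 / 4 * (\<Sum>i<72 * k. x i)\<^sup>2"
      using card_mono_ap3_ge[OF assms n(1)] by metis
    have "4 * real (card (mono_ap3 n \<chi>)) \<ge> 3181 / 3 * (real k)\<^sup>2 - 144 * k - 288"
      using mono below_double_reflected_ge[of k x, OF _ x refl] False by (simp add: power_mult_distrib)
    moreover have "(real n)\<^sup>2 \<le> (72 * real k + 72)\<^sup>2"
      using n by (intro power_mono) auto
    moreover have "(72 * real k + 72)\<^sup>2 = 5184 * (real k)\<^sup>2 + 10368 * k + 5184"
      by (simp add: power2_eq_square algebra_simps)
    \<comment> \<open>With these, the claim is linear in \<open>k^2\<close>, \<open>k\<close> and \<open>n\<close>: the leading coefficients satisfy \<open>1675/8192 * 5184 < 3181/3\<close>.\<close>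
    moreover have "1 \<le> real k" using False by simp
    moreover have "72 * real k \<le> n" using n(1) by linarith
    moreover have "0 \<le> (real k)\<^sup>2" by simp
    ultimately show ?thesis by linarith
  qed
qed

theorem theorem4:
  shows "\<exists>\<epsilon> :: nat \<Rightarrow> real. \<epsilon> \<longlonglongrightarrow> 0 \<and>
    (\<forall>n\<ge>1. real (V n) \<ge> 1675 / 32768 * (real n)\<^sup>2 * (1 + \<epsilon> n))"
proof (intro exI conjI allI impI)
  show "(\<lambda>n. - (20 * 32768 / 1675) / real n) \<longlonglongrightarrow> 0"
    by (rule lim_const_over_n)
  fix n :: nat assume "1 \<le> n"
  have "V n \<in> (\<lambda>\<chi>. card (mono_ap3 n \<chi>)) ` two_colorings n"
    unfolding V_def using finite_two_colorings two_colorings_nonempty by (intro Min_in) auto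
  then have "real (V n) \<ge> 1675 / 32768 * (real n)\<^sup>2 - 20 * real n"
    using mono_ap3_ge by auto
  also have "1675 / 32768 * (real n)\<^sup>2 - 20 * real n = 1675 / 32768 * (real n)\<^sup>2 * (1 + - (20 * 32768 / 1675) / real n)"
    using \<open>1 \<le> n\<close> by (simp add: power2_eq_square field_simps)
  finally show "real (V n) \<ge> 1675 / 32768 * (real n)\<^sup>2 * (1 + - (20 * 32768 / 1675) / real n)" .
qed

end
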